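(* Let $(T,\Sigma,\mu)$ be a complete finite measure space, let $E$ be an infinite-dimensional separable real Banach space with norm dual $E^*$, and let $X$ be an uncountable compact Polish space. Suppose that for every integrably bounded measurable function $\Phi:T\times X\to E^*$ such that $\Phi(t,\cdot):X\to E^*$ is continuous in the weak$^*$ topology of $E^*$ for every $t\in T$, and for every $\lambda\in\mathcal{R}(T,X)$, there exists $f\in\mathcal{M}(T,X)$ satisfying $$\int_T\int_X\Phi(t,x)\,\lambda(t,dx)\,d\mu=\int_T\Phi(t,f(t))\,d\mu .$$ Then $(T,\Sigma,\mu)$ is saturated.
   Context: A finite measure space $(T,\Sigma,\mu)$ is saturated if for every $S\in\Sigma$ with $\mu(S)>0$ the space $L^1_S(\mu)$ of $\mu$-integrable functions on $(S,\Sigma_S)$, $\Sigma_S=\{A\cap S: A\in\Sigma\}$, is nonseparable. $\Pi(X)$ is the set of Borel probability measures on $X$ with the topology of weak convergence, i.e. the coarsest topology making $P\mapsto\int u\,dP$ continuous for every bounded continuous $u:X\to\mathbb{R}$, and is given its Borel $\sigma$-algebra. $\mathcal{M}(T,X)$ is the set of measurable functions $T\to X$; $\mathcal{R}(T,X)$ is the set of measurable functions $\lambda:T\to\Pi(X)$ (relaxed controls), and $\lambda(t,dx)$ denotes integration with respect to $\lambda(t)$. Measurability of $\Phi$ is with respect to $\Sigma\otimes\mathrm{Borel}(X)$ and the Borel $\sigma$-algebra of the weak$^*$ topology of $E^*$. $\Phi$ is integrably bounded if there is $\psi\in L^1(\mu)$ with $\|\Phi(t,x)\|\le\psi(t)$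 for all $(t,x)\in T\times X$. All integrals of $E^*$-valued functions are Gelfand integrals: for a measure $\nu$ and $g$ with values in $E^*$ and $\langle g(\cdot),y\rangle$ $\nu$-integrable for all $y\in E$, $\int g\,d\nu\in E^*$ is the element with $\langle\int g\,d\nu,y\rangle=\int\langle g,y\rangle d\nu$ for every $y\in E$. *)

theory Defs
  imports "HOL-Probability.Probability"
begin

definition borel_of :: "'a topology \<Rightarrow> 'a measure" where
  "borel_of X = sigma (topspace X) {U. openin X U}"

subsection \<open>Saturated measure spaces\<close>

text \<open>
  \<open>L1_topology N\<close> is the topology of the seminorm \<open>\<lambda>f. \<integral>|f| dN\<close> on the integrable functions,
  without passing to the quotient by almost everywhere equality. The quotient map is an isometry
  of the pseudometrics, so the quotient is separable iff this space is. For the same reason it is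
  harmless that functions are not restricted to the set \<open>space N\<close>.
\<close>

definition L1_topology :: "'a measure \<Rightarrow> ('a \<Rightarrow> real) topology" where
  "L1_topology N = topology_generated_by
     {{g. integrable N g \<and> (\<integral>s. \<bar>g s - f s\<bar> \<partial>N) < e} | f e. integrable N f \<and> e > 0}"

lemma openin_L1_topology:
  "openin (L1_topology N) U \<longleftrightarrow>
     U \<subseteq> {f. integrable N f} \<and>
     (\<forall>f\<in>U. \<exists>e>0. {g. integrable N g \<and> (\<integral>s. \<bar>g s - f s\<bar> \<partial>N) < e} \<subseteq> U)"
proof -
  define B :: "('a \<Rightarrow> real) \<Rightarrow> real \<Rightarrow> ('a \<Rightarrow> real) set"
    where "B = (\<lambda>f e. {g. integrable N g \<and> (\<integral>s. \<bar>g s - f s\<bar> \<partial>N) < e})"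
  define S where "S = {B f e | f e. integrable N f \<and> e > 0}"
  have top: "L1_topology N = topology_generated_by S"
    unfolding L1_topology_def S_def B_def ..
  have "U \<subseteq> {f. integrable N f} \<and> (\<forall>f\<in>U. \<exists>e>0. B f e \<subseteq> U)"
    if "generate_topology_on S U"
    using that
  proof (induction rule: generate_topology_on.induct)
    case Empty
    show ?case by simp
  next
    case (Int a b)
    have "\<exists>e>0. B f e \<subseteq> a \<inter> b" if "f \<in> a \<inter> b" for f
    proof -
      obtain d e where "d > 0" "e > 0" "B f d \<subseteq> a" "B f e \<subseteq> b"
        using Int.IH \<open>f \<in> a \<inter> b\<close> by (metis IntD1 IntD2)
      then show ?thesis
        by (intro exI[of _ "min d e"]) (auto simp: B_def)
    qed
    then show ?case using Int.IH by (simp add: le_infI1)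
  next
    case (UN K)
    have "\<exists>e>0. B f e \<subseteq> \<Union>K" if f: "f \<in> \<Union>K" for f
    proof -
      from f obtain k where k: "k \<in> K" "f \<in> k" by auto
      with UN.IH[OF k(1)] obtain e where "e > 0" "B f e \<subseteq> k" by auto
      with k(1) show ?thesis by (intro exI[of _ e]) auto
    qed
    moreover have "\<Union>K \<subseteq> {f. integrable N f}" using UN.IH by (intro Union_least) simp
    ultimately show ?case by simp
  next
    case (Basis b)
    then obtain f e where f: "integrable N f" "b = B f e"
      by (auto simp: S_def)
    have "\<exists>d>0. B g d \<subseteq> b" if "g \<in> b" for g
    proof (intro exI conjI)
      let ?d = "e - (\<integral>s. \<bar>g s - f s\<bar> \<partial>N)"
      have g: "integrable N g" "?d > 0" using that by (auto simp: f B_def)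
      then show "?d > 0" by simp
      show "B g ?d \<subseteq> b"
      proof
        fix h assume "h \<in> B g ?d"
        then have h: "integrable N h" "(\<integral>s. \<bar>h s - g s\<bar> \<partial>N) < ?d" by (auto simp: B_def)
        have "(\<integral>s. \<bar>h s - f s\<bar> \<partial>N) \<le> (\<integral>s. \<bar>h s - g s\<bar> + \<bar>g s - f s\<bar> \<partial>N)"
          using f g h by (intro integral_mono) auto
        also have "\<dots> = (\<integral>s. \<bar>h s - g s\<bar> \<partial>N) + (\<integral>s. \<bar>g s - f s\<bar> \<partial>N)"
          using f g h by (intro Bochner_Integration.integral_add) auto
        finally show "h \<in> b" using h by (simp add: f B_def)
      qed
    qed
    moreover have "b \<subseteq> {f. integrable N f}" by (auto simp: f B_def)
    ultimately show ?case by simp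
  qed
  moreover have "generate_topology_on S U"
    if U: "U \<subseteq> {f. integrable N f} \<and> (\<forall>f\<in>U. \<exists>e>0. B f e \<subseteq> U)"
  proof -
    have "f \<in> \<Union>{b \<in> S. b \<subseteq> U}" if f: "f \<in> U" for f
    proof -
      have int: "integrable N f" using U f by auto
      obtain e where e: "e > 0" "B f e \<subseteq> U" using U f by auto
      have "B f e \<in> S" unfolding S_def using int e(1) by auto
      moreover have "f \<in> B f e" using int e(1) by (simp add: B_def)
      ultimately show ?thesis using e(2) by auto
    qed
    then have "U = \<Union>{b \<in> S. b \<subseteq> U}" by (intro equalityI subsetI) auto
    moreover have "generate_topology_on S (\<Union>{b \<in> S. b \<subseteq> U})"
      by (rule generate_topology_on.UN) (auto intro: generate_topology_on.Basis)
    ultimately show ?thesis by simp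
  qed
  ultimately show ?thesis
    unfolding top openin_topology_generated_by_iff unfolding B_def by (rule iffI)
qed

definition saturated :: "'t measure \<Rightarrow> bool" where
  "saturated M \<longleftrightarrow> finite_measure M \<and>
     (\<forall>S\<in>sets M. emeasure M S > 0 \<longrightarrow> \<not> separable_space (L1_topology (restrict_space M S)))"

subsection \<open>Relaxed controls\<close>

definition borel_prob_measures :: "'x::topological_space measure set" where
  "borel_prob_measures = {P. sets P = sets borel \<and> prob_space P}"

definition weak_convergence_topology :: "'x::topological_space measure topology" where
  "weak_convergence_topology = topology_generated_by
     {{P \<in> borel_prob_measures. (\<integral>x. u x \<partial>P) \<in> U} | (u :: 'x \<Rightarrow> real) U.
        continuous_on UNIV u \<and> bounded (range u) \<and> open U}"

lemma topspace_weak_convergence_topology: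
  "topspace weak_convergence_topology = borel_prob_measures"
proof -
  have "borel_prob_measures \<in>
      {{P \<in> borel_prob_measures. (\<integral>x. u x \<partial>P) \<in> U} | (u :: 'a \<Rightarrow> real) U.
        continuous_on UNIV u \<and> bounded (range u) \<and> open U}"
    by (rule CollectI, rule exI[of _ "\<lambda>_. 0"], rule exI[of _ UNIV]) auto
  then show ?thesis
    unfolding weak_convergence_topology_def topology_generated_by_topspace
    by (intro equalityI Union_least Union_upper) auto
qed

definition relaxed_controls :: "'t measure \<Rightarrow> ('t \<Rightarrow> 'x::topological_space measure) set" where
  "relaxed_controls M = measurable M (borel_of weak_convergence_topology)"

subsection \<open>The weak* topology and the Gelfand integral\<close>

text \<open>
  The norm dual of \<open>'e\<close> is \<open>'e \<Rightarrow>\<^sub>L real\<close> with the operator norm. The strong operator topology is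
  the topology of pointwise convergence, which for functionals is the weak* topology.
\<close>

definition weak_star_topology :: "('e::real_normed_vector \<Rightarrow>\<^sub>L real) topology" where
  "weak_star_topology = strong_operator_topology"

definition has_gelfand_integral ::
    "'a measure \<Rightarrow> ('a \<Rightarrow> 'e::real_normed_vector \<Rightarrow>\<^sub>L real) \<Rightarrow> ('e \<Rightarrow>\<^sub>L real) \<Rightarrow> bool" where
  "has_gelfand_integral N g v \<longleftrightarrow>
     (\<forall>y. integrable N (\<lambda>s. blinfun_apply (g s) y) \<and>
          blinfun_apply v y = (\<integral>s. blinfun_apply (g s) y \<partial>N))"

definition gelfand_integral ::
    "'a measure \<Rightarrow> ('a \<Rightarrow> 'e::real_normed_vector \<Rightarrow>\<^sub>L real) \<Rightarrow> 'e \<Rightarrow>\<^sub>L real" where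
  "gelfand_integral N g = (THE v. has_gelfand_integral N g v)"

lemma gelfand_integral_eq:
  assumes "has_gelfand_integral N g v"
  shows "gelfand_integral N g = v"
  unfolding gelfand_integral_def using assms
  by (intro the_equality) (auto simp: has_gelfand_integral_def intro!: blinfun_eqI)

lemma has_gelfand_integral_gelfand_integral:
  fixes g :: "'a \<Rightarrow> 'e::real_normed_vector \<Rightarrow>\<^sub>L real"
  assumes int: "\<And>y. integrable N (\<lambda>s. blinfun_apply (g s) y)"
    and psi: "integrable N \<psi>" "\<And>s. s \<in> space N \<Longrightarrow> norm (g s) \<le> \<psi> s"
  shows "has_gelfand_integral N g (gelfand_integral N g)"
proof -
  let ?v = "\<lambda>y. \<integral>s. blinfun_apply (g s) y \<partial>N"
  have "bounded_linear ?v"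
  proof (rule bounded_linear_intro[where K = "\<integral>s. \<psi> s \<partial>N"])
    fix y
    have "norm (?v y) \<le> (\<integral>s. norm (blinfun_apply (g s) y) \<partial>N)"
      by (rule integral_norm_bound)
    also have "\<dots> \<le> (\<integral>s. \<psi> s * norm y \<partial>N)"
    proof (rule integral_mono)
      fix s assume "s \<in> space N"
      then show "norm (blinfun_apply (g s) y) \<le> \<psi> s * norm y"
        using norm_blinfun[of "g s" y] mult_right_mono[OF psi(2) norm_ge_zero[of y]]
        by fastforce
    qed (use int psi in auto)
    finally show "norm (?v y) \<le> norm y * (\<integral>s. \<psi> s \<partial>N)" by (simp add: mult.commute)
  qed (simp_all add: blinfun.add_right blinfun.scaleR_right int)
  then have "has_gelfand_integral N g (Blinfun ?v)"
    using int by (simp add: has_gelfand_integral_def bounded_linear_Blinfun_apply)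
  with gelfand_integral_eq[OF this] show ?thesis by simp
qed

definition integrably_bounded ::
    "'t measure \<Rightarrow> ('t \<times> 'x \<Rightarrow> 'e::real_normed_vector \<Rightarrow>\<^sub>L real) \<Rightarrow> bool" where
  "integrably_bounded M \<Phi> \<longleftrightarrow>
     (\<exists>\<psi>. integrable M \<psi> \<and> (\<forall>t\<in>space M. \<forall>x. norm (\<Phi> (t, x)) \<le> \<psi> t))"

end

theory Submission
  imports Defs
begin

text \<open>
  Suppose that \<open>L\<^sup>1\<close> of some \<open>S\<close> of positive measure is separable, and truncate a dense sequence
  to functions \<open>v\<^sub>n\<close> with values in \<open>[-1, 1]\<close>; a bounded function on \<open>S\<close> orthogonal to all \<open>v\<^sub>n\<close>
  vanishes almost everywhere. Let \<open>(y\<^sub>n, b\<^sub>n)\<close> be biorthogonal in \<open>E \<times> E\<^sup>*\<close>, up to scaling such that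
  \<open>\<Sum> \<parallel>b\<^sub>n\<parallel> < \<infinity>\<close>, let \<open>h : X \<rightarrow> [0, 1]\<close> be continuous with \<open>h p = 0\<close> and \<open>h q = 1\<close>, and relax
  \<open>\<Phi>(t, x) = 1\<^sub>S(t) ((h(x)\<^sup>2 - h(x)) b\<^sub>0 + \<Sum> v\<^sub>n(t) h(x) b\<^sub>n\<^sub>+\<^sub>1)\<close> by the uniform measure on \<open>{p, q}\<close>.
  For a purifying \<open>f\<close>, testing with \<open>y\<^sub>n\<^sub>+\<^sub>1\<close> gives \<open>\<integral>\<^sub>S v\<^sub>n (h \<circ> f - 1/2) = 0\<close> for all \<open>n\<close>, so
  \<open>h \<circ> f = 1/2\<close> almost everywhere on \<open>S\<close>, whereas testing with \<open>y\<^sub>0\<close> gives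
  \<open>\<integral>\<^sub>S ((h \<circ> f)\<^sup>2 - h \<circ> f) = 0\<close>.
\<close>


section \<open>Sublinear functionals and the Hahn-Banach theorem\<close>

definition sublinear :: "('a::real_vector \<Rightarrow> real) \<Rightarrow> bool" where
  "sublinear q \<longleftrightarrow> (\<forall>x y. q (x + y) \<le> q x + q y) \<and> (\<forall>c>0. \<forall>x. q (c *\<^sub>R x) \<le> c * q x)"

lemma sublinearI:
  assumes "\<And>x y. q (x + y) \<le> q x + q y" "\<And>c x. c > 0 \<Longrightarrow> q (c *\<^sub>R x) \<le> c * q x"
  shows "sublinear q"
  using assms by (auto simp: sublinear_def)

lemma sublinear_add: "sublinear q \<Longrightarrow> q (x + y) \<le> q x + q y"
  by (simp add: sublinear_def)

lemma sublinear_scaleR_le: "sublinear q \<Longrightarrow> c > 0 \<Longrightarrow> q (c *\<^sub>R x) \<le> c * q x"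
  by (simp add: sublinear_def)

lemma sublinear_scaleR:
  assumes "sublinear q" "c > 0"
  shows "q (c *\<^sub>R x) = c * q x"
proof (rule antisym)
  have "q (inverse c *\<^sub>R c *\<^sub>R x) \<le> inverse c * q (c *\<^sub>R x)"
    using assms by (intro sublinear_scaleR_le) auto
  then show "c * q x \<le> q (c *\<^sub>R x)" using assms(2) by (simp add: field_simps)
qed (rule sublinear_scaleR_le[OF assms])

lemma sublinear_zero:
  assumes "sublinear q"
  shows "q 0 = 0"
  using sublinear_scaleR[OF assms, of 2 0] by simp

lemma sublinear_minus_le:
  assumes "sublinear q"
  shows "- q (- x) \<le> q x"
  using sublinear_add[OF assms, of x "- x"] sublinear_zero[OF assms] by simp

lemma sublinear_norm: "sublinear norm"
  by (rule sublinearI) (auto simp: norm_triangle_ineq)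

text \<open>For sublinear \<open>q\<close> this is the largest sublinear functional below
  \<open>q\<close> whose value at \<open>- y\<close> is at most \<open>- q y\<close>.\<close>

definition sublinear_descent :: "('a::real_vector \<Rightarrow> real) \<Rightarrow> 'a \<Rightarrow> 'a \<Rightarrow> real" where
  "sublinear_descent q y x = (INF t\<in>{0..}. q (x + t *\<^sub>R y) - t * q y)"

text \<open>The infimum is finite because subadditivity bounds every term below by
  \<open>- q (- x)\<close>. Subadditivity of the descent comes from adding the parameters
  \<open>t\<close> and \<open>s\<close> of two terms, homogeneity from replacing \<open>t\<close> by
  \<open>c * t\<close>.\<close>

lemma
  assumes q: "sublinear q"
  shows sublinear_descent_le: "t \<ge> 0 \<Longrightarrow> sublinear_descent q y x \<le> q (x + t *\<^sub>R y) - t * q y"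
    and sublinear_descent: "sublinear (sublinear_descent q y)"
proof -
  have lb: "- q (- x) \<le> q (x + t *\<^sub>R y) - t * q y" if "t \<ge> 0" for x t
  proof -
    have "q (t *\<^sub>R y) = t * q y"
      using that sublinear_scaleR[OF q, of t y] sublinear_zero[OF q] by (cases "t = 0") auto
    then show ?thesis
      using sublinear_add[OF q, of "x + t *\<^sub>R y" "- x"] by simp
  qed
  have le: "sublinear_descent q y x \<le> q (x + t *\<^sub>R y) - t * q y" if "t \<ge> 0" for t x
    unfolding sublinear_descent_def
    using that lb by (intro cINF_lower bdd_belowI2[where m = "- q (- x)"]) auto
  then show "t \<ge> 0 \<Longrightarrow> sublinear_descent q y x \<le> q (x + t *\<^sub>R y) - t * q y" .
  have greatest: "l \<le> sublinear_descent q y x"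
    if "\<And>t. t \<ge> 0 \<Longrightarrow> l \<le> q (x + t *\<^sub>R y) - t * q y" for l x
    unfolding sublinear_descent_def using that by (intro cINF_greatest) auto
  show "sublinear (sublinear_descent q y)"
  proof (rule sublinearI)
    fix x z
    have "sublinear_descent q y (x + z) - (q (x + t *\<^sub>R y) - t * q y) \<le> sublinear_descent q y z"
      if "t \<ge> 0" for t
    proof (rule greatest)
      fix s :: real assume "s \<ge> 0"
      then show "sublinear_descent q y (x + z) - (q (x + t *\<^sub>R y) - t * q y)
          \<le> q (z + s *\<^sub>R y) - s * q y"
        using le[of "t + s" "x + z"] that sublinear_add[OF q, of "x + t *\<^sub>R y" "z + s *\<^sub>R y"]
        by (simp add: algebra_simps)
    qed
    then have "sublinear_descent q y (x + z) - sublinear_descent q y z \<le> sublinear_descent q y x"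
      by (intro greatest) (simp add: algebra_simps)
    then show "sublinear_descent q y (x + z) \<le> sublinear_descent q y x + sublinear_descent q y z"
      by simp
  next
    fix c :: real and x assume c: "c > 0"
    have "sublinear_descent q y (c *\<^sub>R x) / c \<le> sublinear_descent q y x"
    proof (rule greatest)
      fix t :: real assume "t \<ge> 0"
      then show "sublinear_descent q y (c *\<^sub>R x) / c \<le> q (x + t *\<^sub>R y) - t * q y"
        using le[of "c * t" "c *\<^sub>R x"] c sublinear_scaleR[OF q c, of "x + t *\<^sub>R y"]
        by (simp add: field_simps scaleR_add_right)
    qed
    then show "sublinear_descent q y (c *\<^sub>R x) \<le> c * sublinear_descent q y x"
      using c by (simp add: field_simps)
  qed
qed

text \<open>
  The Hahn--Banach theorem: a minimal sublinear functional \<open>q\<close> below \<open>p\<close> equals its descent along every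
  \<open>y\<close>, which forces \<open>q x + q y \<le> q (x + y)\<close>.
\<close>

lemma sublinear_dominates_linear:
  assumes p: "sublinear p"
  obtains f where "linear f" "\<And>x. f x \<le> p x"
proof -
  define A where "A = {q. sublinear q \<and> q \<le> p}"
  \<comment> \<open>The order is reversed, so that the maximal element given by Zorn's lemma is a
    minimal functional and chains are bounded by pointwise infima.\<close>
  let ?P = "\<lambda>q r :: 'a \<Rightarrow> real. r \<le> q"
  have ex: "\<exists>m\<in>A. \<forall>a\<in>A. ?P m a \<longrightarrow> a = m"
  proof (rule predicate_Zorn)
    show "partial_order_on A (relation_of ?P A)"
      by (rule partial_order_on_relation_ofI) auto
    fix C assume "C \<in> Chains (relation_of ?P A)"
    then have C: "C \<subseteq> A" "\<And>q r. q \<in> C \<Longrightarrow> r \<in> C \<Longrightarrow> q \<le> r \<or> r \<le> q"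
      by (auto simp: Chains_def relation_of_def)
    show "\<exists>u\<in>A. \<forall>a\<in>C. ?P a u"
    proof (cases "C = {}")
      case True
      then show ?thesis using p by (auto simp: A_def)
    next
      case False
      then obtain q0 where q0: "q0 \<in> C" by auto
      have sub: "sublinear q" "q \<le> p" if "q \<in> C" for q using C(1) that by (auto simp: A_def)
      define u where "u x = (INF q\<in>C. q x)" for x
      have le: "u x \<le> q x" if "q \<in> C" for q x
        unfolding u_def
      proof (rule cINF_lower[OF bdd_belowI2[where m = "- p (- x)"] that])
        fix r assume "r \<in> C"
        then show "- p (- x) \<le> r x"
          using sublinear_minus_le[OF sub(1), of r x] le_funD[OF sub(2), of r "- x"] by auto
      qed
      have greatest: "l \<le> u x" if "\<And>q. q \<in> C \<Longrightarrow> l \<le> q x" for l x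
        unfolding u_def using that False by (intro cINF_greatest) auto
      have "sublinear u"
      proof (rule sublinearI)
        fix x y
        \<comment> \<open>Near-optimal members for \<open>x\<close> and for \<open>y\<close> may
          differ; in a chain the smaller one serves both.\<close>
        have "u (x + y) - q x \<le> r y" if qr: "q \<in> C" "r \<in> C" for q r
        proof -
          obtain s where s: "s \<in> C" "s \<le> q" "s \<le> r" using C(2)[OF qr] qr by blast
          show ?thesis
            using le[OF s(1), of "x + y"] sublinear_add[OF sub(1)[OF s(1)], of x y]
              le_funD[OF s(2), of x] le_funD[OF s(3), of y] by linarith
        qed
        then have "u (x + y) - q x \<le> u y" if "q \<in> C" for q
          using that by (intro greatest) auto
        then have "u (x + y) - u y \<le> u x"
          by (intro greatest) (simp add: algebra_simps)
        then show "u (x + y) \<le> u x + u y" by simp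
      next
        fix c :: real and x assume c: "c > 0"
        have "u (c *\<^sub>R x) / c \<le> u x"
        proof (rule greatest)
          fix q assume "q \<in> C"
          then show "u (c *\<^sub>R x) / c \<le> q x"
            using le[of q "c *\<^sub>R x"] sublinear_scaleR_le[OF sub(1) c, of q x] c
            by (simp add: field_simps)
        qed
        then show "u (c *\<^sub>R x) \<le> c * u x" using c by (simp add: field_simps)
      qed
      moreover have "u \<le> p"
        using order_trans[OF le[OF q0] le_funD[OF sub(2)[OF q0]]] by (auto simp: le_fun_def)
      ultimately show ?thesis using le by (auto simp: A_def le_fun_def)
    qed
  qed
  obtain q where q: "sublinear q" "q \<le> p"
    and min: "\<And>r. sublinear r \<Longrightarrow> r \<le> q \<Longrightarrow> r = q"
  proof -
    from ex
    obtain m where m: "sublinear m" "m \<le> p" "\<And>a. a \<in> A \<Longrightarrow> a \<le> m \<Longrightarrow> a = m"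
      unfolding A_def by blast
    show thesis
    proof (rule that[OF m(1,2)])
      fix r assume "sublinear r" "r \<le> m"
      then show "r = m" using m(2) by (intro m(3)) (auto simp: A_def intro: order_trans)
    qed
  qed
  have "q x + q y \<le> q (x + y)" for x y
  proof -
    have "sublinear_descent q y = q"
      using sublinear_descent_le[OF q(1), of 0 y]
      by (intro min sublinear_descent q) (auto simp: le_fun_def)
    then show ?thesis using sublinear_descent_le[OF q(1), of 1 y x] by simp
  qed
  then have add: "q (x + y) = q x + q y" for x y
    using sublinear_add[OF q(1)] by (intro antisym)
  have minus: "q (- x) = - q x" for x
    using add[of x "- x"] sublinear_zero[OF q(1)] by simp
  have "linear q"
  proof (rule linearI[OF add])
    fix c x
    show "q (c *\<^sub>R x) = c *\<^sub>R q x"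
    proof (cases c "0 :: real" rule: linorder_cases)
      case less
      then show ?thesis using sublinear_scaleR[OF q(1), of "- c" x] by (simp add: minus)
    qed (use sublinear_scaleR[OF q(1), of c x] sublinear_zero[OF q(1)] in auto)
  qed
  with q(2) that show thesis by (auto simp: le_fun_def)
qed

text \<open>Domination by the descent of the norm replaces extension from the line through
  \<open>y\<close>: \<open>t = 0\<close> bounds the functional by the norm, and \<open>t = 1\<close>
  makes it nonzero at \<open>y\<close>.\<close>

lemma exists_blinfun_nonzero:
  fixes y :: "'a::real_normed_vector"
  assumes "y \<noteq> 0"
  obtains \<phi> :: "'a \<Rightarrow>\<^sub>L real" where "blinfun_apply \<phi> y \<noteq> 0"
proof -
  \<comment> \<open>The descent of the norm along \<open>y\<close> is at most \<open>- norm y\<close> at \<open>- y\<close>.\<close>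
  obtain f where f: "linear f" "\<And>x. f x \<le> sublinear_descent norm y x"
    using sublinear_dominates_linear[OF sublinear_descent[OF sublinear_norm]] by metis
  have le: "f x \<le> norm x" for x
    using f(2)[of x] sublinear_descent_le[OF sublinear_norm, of 0 y x] by simp
  have "\<bar>f x\<bar> \<le> norm x" for x
    using le[of x] le[of "- x"] linear_neg[OF f(1), of x] by simp
  then have "bounded_linear f"
    using f(1) by (intro bounded_linear_intro[where K = 1]) (auto simp: linear_add linear_cmul)
  moreover have "f (- y) < 0"
    using f(2)[of "- y"] sublinear_descent_le[OF sublinear_norm, of 1 y "- y"] assms
    by (auto intro: order.strict_trans1 dest: order_trans)
  then have "f y \<noteq> 0" using linear_neg[OF f(1), of y] by simp
  ultimately show thesis using that[of "Blinfun f"] by (simp add: bounded_linear_Blinfun_apply)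
qed

section \<open>Biorthogonal sequences\<close>

text \<open>A vector outside the span of the \<open>y i\<close>, minus its expansion in them, is a
  nonzero \<open>z\<close> killed by all \<open>b i\<close>. A functional nonzero at
  \<open>z\<close> is corrected by multiples of the \<open>b i\<close>, which leave its value at
  \<open>z\<close> alone; rescaling \<open>z\<close> makes that value 1.\<close>

lemma extend_biorthogonal:
  fixes y :: "nat \<Rightarrow> 'a::real_normed_vector" and b :: "nat \<Rightarrow> 'a \<Rightarrow>\<^sub>L real"
  assumes inf: "\<not> (\<exists>B :: 'a set. finite B \<and> span B = UNIV)"
    and bi: "\<And>i j. i < n \<Longrightarrow> j < n \<Longrightarrow> blinfun_apply (b i) (y j) = (if i = j then 1 else 0)"
  obtains z and \<phi> :: "'a \<Rightarrow>\<^sub>L real" where "blinfun_apply \<phi> z = 1"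
    "\<And>i. i < n \<Longrightarrow> blinfun_apply \<phi> (y i) = 0" "\<And>i. i < n \<Longrightarrow> blinfun_apply (b i) z = 0"
proof -
  have "span (y ` {..<n}) \<noteq> UNIV" using inf by auto
  then obtain x where x: "x \<notin> span (y ` {..<n})" by auto
  define z where "z = x - (\<Sum>i<n. blinfun_apply (b i) x *\<^sub>R y i)"
  have "(\<Sum>i<n. blinfun_apply (b i) x *\<^sub>R y i) \<in> span (y ` {..<n})"
    by (intro span_sum span_scale span_base) auto
  then have "z \<noteq> 0" using x by (auto simp: z_def)
  then obtain \<phi> :: "'a \<Rightarrow>\<^sub>L real" where \<phi>: "blinfun_apply \<phi> z \<noteq> 0"
    using exists_blinfun_nonzero by blast
  have z: "blinfun_apply (b i) z = 0" if "i < n" for i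
    using that by (simp add: z_def blinfun.diff_right blinfun.sum_right blinfun.scaleR_right bi
        if_distrib cong: if_cong)
  define \<phi>' where "\<phi>' = \<phi> - (\<Sum>i<n. blinfun_apply \<phi> (y i) *\<^sub>R b i)"
  have "blinfun_apply \<phi>' (y i) = 0" if "i < n" for i
    using that by (simp add: \<phi>'_def blinfun.diff_left blinfun.sum_left blinfun.scaleR_left bi
        if_distrib cong: if_cong)
  moreover have "blinfun_apply \<phi>' z = blinfun_apply \<phi> z"
    by (simp add: \<phi>'_def blinfun.diff_left blinfun.sum_left blinfun.scaleR_left z)
  ultimately show thesis
    using \<phi> z that[of "\<phi>'" "(1 / blinfun_apply \<phi> z) *\<^sub>R z"] by (simp add: blinfun.scaleR_right)
qed

lemma exists_biorthogonal_sequence: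
  assumes inf: "\<not> (\<exists>B :: 'a set. finite B \<and> span B = UNIV)"
  obtains y :: "nat \<Rightarrow> 'a::real_normed_vector" and b :: "nat \<Rightarrow> 'a \<Rightarrow>\<^sub>L real"
  where "\<And>i j. blinfun_apply (b i) (y j) = (if i = j then 1 else 0)"
proof -
  \<comment> \<open>\<open>R\<close> relates the pair \<open>r\<close> to earlier pairs only, but in
    both directions, so the cases \<open>i < j\<close> and \<open>j < i\<close> are both settled at
    the later index.\<close>
  define R :: "(nat \<Rightarrow> 'a \<times> ('a \<Rightarrow>\<^sub>L real)) \<Rightarrow> nat \<Rightarrow> 'a \<times> ('a \<Rightarrow>\<^sub>L real) \<Rightarrow> bool"
    where "R f n r \<longleftrightarrow> blinfun_apply (snd r) (fst r) = 1 \<and>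
      (\<forall>i<n. blinfun_apply (snd r) (fst (f i)) = 0 \<and> blinfun_apply (snd (f i)) (fst r) = 0)"
    for f n r
  have "\<exists>f. \<forall>n. R f n (f n)"
  proof (rule dependent_wellorder_choice)
    show "R f n r = R g n r" if "\<And>i. i < n \<Longrightarrow> f i = g i" for r f g n
      using that by (auto simp: R_def)
    fix n f
    assume "\<And>i. i < n \<Longrightarrow> R f i (f i)"
    then have bi: "blinfun_apply (snd (f i)) (fst (f j)) = (if i = j then 1 else 0)"
      if "i < n" "j < n" for i j
      using that by (cases i j rule: linorder_cases) (auto simp: R_def)
    obtain z and \<phi> :: "'a \<Rightarrow>\<^sub>L real" where "blinfun_apply \<phi> z = 1"
      "\<And>i. i < n \<Longrightarrow> blinfun_apply \<phi> (fst (f i)) = 0"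
      "\<And>i. i < n \<Longrightarrow> blinfun_apply (snd (f i)) z = 0"
      using extend_biorthogonal[OF inf bi] by metis
    then have "R f n (z, \<phi>)" by (simp add: R_def)
    then show "\<exists>r. R f n r" ..
  qed
  then obtain f where f: "\<And>n. R f n (f n)" by blast
  have "blinfun_apply (snd (f i)) (fst (f j)) = (if i = j then 1 else 0)" for i j
    using f[of i] f[of j] by (cases i j rule: linorder_cases) (auto simp: R_def)
  then show thesis using that[of "\<lambda>i. snd (f i)" "\<lambda>j. fst (f j)"] by blast
qed

section \<open>Series with bounded coefficients\<close>

text \<open>
  The dual may be nonseparable, so measurability of \<open>\<Phi>\<close> is not inherited from partial sums;
  instead \<open>\<Phi>\<close> factors through this continuous function of its coefficient sequence, which the
  truncation makes total.
\<close>

lemma continuous_on_clipped_series: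
  fixes b :: "nat \<Rightarrow> 'b::banach"
  assumes "summable (\<lambda>n. norm (b n))"
  shows "continuous_on UNIV (\<lambda>c :: nat \<Rightarrow> real. \<Sum>n. max (- 1) (min 1 (c n)) *\<^sub>R b n)"
proof -
  have lim: "uniform_limit UNIV (\<lambda>N c. \<Sum>n<N. max (- 1) (min 1 (c n :: real)) *\<^sub>R b n)
      (\<lambda>c. \<Sum>n. max (- 1) (min 1 (c n)) *\<^sub>R b n) sequentially"
  proof (rule Weierstrass_m_test[OF _ assms])
    fix n and c :: "nat \<Rightarrow> real"
    have "\<bar>max (- 1) (min 1 (c n))\<bar> \<le> 1" by auto
    then show "norm (max (- 1) (min 1 (c n)) *\<^sub>R b n) \<le> norm (b n)"
      by (simp add: mult_left_le_one_le)
  qed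
  have coord: "continuous_on UNIV (\<lambda>c :: nat \<Rightarrow> real. c n)" for n
    by (rule continuous_on_product_coordinates)
  have clip: "continuous_on UNIV (\<lambda>c :: nat \<Rightarrow> real. max (- 1) (min 1 (c n)))" for n
    by (rule continuous_on_max[OF continuous_on_const continuous_on_min[OF continuous_on_const coord]])
  have partial: "continuous_on UNIV (\<lambda>c :: nat \<Rightarrow> real. \<Sum>n<N. max (- 1) (min 1 (c n)) *\<^sub>R b n)" for N
    by (intro continuous_on_sum continuous_on_scaleR clip continuous_on_const)
  show ?thesis
    by (rule uniform_limit_theorem[OF _ lim]) (simp_all add: partial)
qed

lemma summable_bounded_coefficients:
  fixes b :: "nat \<Rightarrow> 'b::banach" and c :: "nat \<Rightarrow> real"
  assumes b: "summable (\<lambda>n. norm (b n))" and c: "\<And>n. \<bar>c n\<bar> \<le> 1"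
  shows "summable (\<lambda>n. c n *\<^sub>R b n)" "norm (\<Sum>n. c n *\<^sub>R b n) \<le> (\<Sum>n. norm (b n))"
proof -
  have le: "norm (c n *\<^sub>R b n) \<le> norm (b n)" for n
    using c[of n] by (simp add: mult_left_le_one_le)
  then show "summable (\<lambda>n. c n *\<^sub>R b n)"
    by (intro summable_comparison_test'[OF b, of 0]) auto
  have "summable (\<lambda>n. norm (c n *\<^sub>R b n))"
    using le by (intro summable_comparison_test'[OF b, of 0]) auto
  then show "norm (\<Sum>n. c n *\<^sub>R b n) \<le> (\<Sum>n. norm (b n))"
    by (intro order_trans[OF summable_norm suminf_le[OF le _ b]])
qed

section \<open>Separable L1 spaces\<close>

text \<open>Some \<open>u n\<close> of a dense sequence is L1-close to \<open>w\<close>. Clipping to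
  [-1, 1] fixes the values of \<open>w\<close> and increases no distance, so \<open>v n\<close> is
  as close. By orthogonality the integral of \<open>w\<close> squared equals that of
  \<open>w * (w - v n)\<close>, which is at most the L1 distance from \<open>v n\<close> to
  \<open>w\<close>.\<close>

lemma separable_L1_determining_sequence:
  assumes "finite_measure N" and sep: "separable_space (L1_topology N)"
  obtains v :: "nat \<Rightarrow> 'a \<Rightarrow> real"
  where "\<And>n. v n \<in> borel_measurable N" "\<And>n s. \<bar>v n s\<bar> \<le> 1"
    "\<And>w. w \<in> borel_measurable N \<Longrightarrow> (\<And>s. \<bar>w s\<bar> \<le> 1) \<Longrightarrow>
      (\<And>n. (\<integral>s. v n s * w s \<partial>N) = 0) \<Longrightarrow> (\<integral>s. (w s)\<^sup>2 \<partial>N) = 0"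
proof -
  interpret finite_measure N by fact
  have top: "topspace (L1_topology N) = {f. integrable N f}"
  proof
    show "topspace (L1_topology N) \<subseteq> {f. integrable N f}"
      using openin_topspace[of "L1_topology N"] unfolding openin_L1_topology by simp
    show "{f. integrable N f} \<subseteq> topspace (L1_topology N)"
      by (intro openin_subset) (auto simp: openin_L1_topology intro: exI[of _ 1])
  qed
  have opn: "openin (L1_topology N) {g. integrable N g \<and> (\<integral>s. \<bar>g s - f s\<bar> \<partial>N) < e}"
    if "integrable N f" "e > 0" for f e
    unfolding L1_topology_def using that by (intro topology_generated_by_Basis) auto
  obtain C where C: "countable C" "C \<subseteq> {f. integrable N f}"
    "L1_topology N closure_of C = {f. integrable N f}"
    using sep unfolding separable_space_def top by auto
  have dense: "\<exists>u\<in>C. (\<integral>s. \<bar>u s - f s\<bar> \<partial>N) < e" if f: "integrable N f" and e: "e > 0" for f e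
  proof -
    have "f \<in> L1_topology N closure_of C" using C(3) f by simp
    moreover have "f \<in> {g. integrable N g \<and> (\<integral>s. \<bar>g s - f s\<bar> \<partial>N) < e}" using f e by simp
    ultimately obtain u where "u \<in> C" "u \<in> {g. integrable N g \<and> (\<integral>s. \<bar>g s - f s\<bar> \<partial>N) < e}"
      using opn[OF f e] unfolding in_closure_of by meson
    then show ?thesis by auto
  qed
  have "C \<noteq> {}" using dense[of "\<lambda>_. 0" 1] by auto
  define u where "u = from_nat_into C"
  have u: "integrable N (u n)" for n
    using from_nat_into[OF \<open>C \<noteq> {}\<close>, of n] C(2) by (auto simp: u_def)
  have u_dense: "\<exists>n. (\<integral>s. \<bar>u n s - f s\<bar> \<partial>N) < e" if "integrable N f" "e > 0" for f e
    using dense[OF that] from_nat_into_surj[OF C(1)] unfolding u_def by metis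
  define v where "v n s = max (- 1) (min 1 (u n s))" for n s
  have [measurable]: "u n \<in> borel_measurable N" for n using u[of n] by simp
  have v_meas [measurable]: "v n \<in> borel_measurable N" for n unfolding v_def by measurable
  have v_le: "\<bar>v n s\<bar> \<le> 1" for n s by (auto simp: v_def)
  show thesis
  proof (rule that[of v, OF v_meas v_le])
    fix w :: "'a \<Rightarrow> real"
    assume [measurable]: "w \<in> borel_measurable N" and w_le: "\<And>s. \<bar>w s\<bar> \<le> 1"
      and orth: "\<And>n. (\<integral>s. v n s * w s \<partial>N) = 0"
    have w_int: "integrable N w"
      using w_le by (intro integrable_const_bound[where B = 1]) auto
    have w2_int: "integrable N (\<lambda>s. (w s)\<^sup>2)"
      using w_le by (intro integrable_const_bound[where B = 1]) (auto simp: abs_square_le_1)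
    have vw_int: "integrable N (\<lambda>s. v n s * w s)" for n
      using w_le v_le by (intro integrable_const_bound[where B = 1]) (auto simp: abs_mult mult_le_one)
    have "(\<integral>s. (w s)\<^sup>2 \<partial>N) \<le> 0 + e" if e: "e > 0" for e
    proof -
      obtain n where n: "(\<integral>s. \<bar>u n s - w s\<bar> \<partial>N) < e" using u_dense[OF w_int e] by auto
      have "(\<integral>s. (w s)\<^sup>2 \<partial>N) = (\<integral>s. (w s)\<^sup>2 - v n s * w s \<partial>N)"
        using orth w2_int vw_int by simp
      also have "\<dots> \<le> (\<integral>s. \<bar>u n s - w s\<bar> \<partial>N)"
      proof (rule integral_mono)
        fix s
        have "(w s)\<^sup>2 - v n s * w s \<le> \<bar>w s\<bar> * \<bar>w s - v n s\<bar>"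
          using abs_ge_self[of "w s * (w s - v n s)"] unfolding abs_mult
          by (simp add: algebra_simps power2_eq_square)
        also have "\<dots> \<le> \<bar>w s - v n s\<bar>" using w_le by (simp add: mult_left_le_one_le)
        also have "\<dots> \<le> \<bar>u n s - w s\<bar>" using w_le[of s] by (auto simp: v_def)
        finally show "(w s)\<^sup>2 - v n s * w s \<le> \<bar>u n s - w s\<bar>" .
      qed (use w2_int vw_int u w_int in auto)
      finally show ?thesis using n by simp
    qed
    then have "(\<integral>s. (w s)\<^sup>2 \<partial>N) \<le> 0" by (rule field_le_epsilon)
    then show "(\<integral>s. (w s)\<^sup>2 \<partial>N) = 0" by (intro antisym) auto
  qed
qed

section \<open>Two-point measures and weak* measurability\<close>

text \<open>\<open>distr\<close> to \<open>borel\<close> cuts the sigma-algebra of the pmf, which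
  has all subsets, down to the Borel sets demanded by \<open>borel_prob_measures\<close>.\<close>

definition two_point_measure :: "'x::topological_space \<Rightarrow> 'x \<Rightarrow> 'x measure" where
  "two_point_measure a b = distr (measure_pmf (pmf_of_set {a, b})) borel (\<lambda>x. x)"

lemma two_point_measure_in_borel_prob_measures:
  "two_point_measure a b \<in> borel_prob_measures"
  unfolding two_point_measure_def borel_prob_measures_def
  by (auto intro!: measure_pmf.prob_space_distr)

lemma has_gelfand_integral_two_point_measure:
  fixes g :: "'x::topological_space \<Rightarrow> 'e::real_normed_vector \<Rightarrow>\<^sub>L real"
  assumes "a \<noteq> b" and [measurable]: "\<And>y. (\<lambda>x. blinfun_apply (g x) y) \<in> borel_measurable borel"
  shows "has_gelfand_integral (two_point_measure a b) g ((1/2) *\<^sub>R (g a + g b))"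
  unfolding has_gelfand_integral_def
proof (intro allI conjI)
  fix y
  show "integrable (two_point_measure a b) (\<lambda>x. blinfun_apply (g x) y)"
    unfolding two_point_measure_def
    by (subst integrable_distr_eq) (auto intro!: integrable_measure_pmf_finite)
  show "blinfun_apply ((1/2) *\<^sub>R (g a + g b)) y
      = (\<integral>x. blinfun_apply (g x) y \<partial>two_point_measure a b)"
    unfolding two_point_measure_def
    using \<open>a \<noteq> b\<close>
    by (subst integral_distr)
      (auto simp: integral_pmf_of_set blinfun.add_left blinfun.scaleR_left)
qed

lemma const_in_relaxed_controls:
  assumes "P \<in> borel_prob_measures"
  shows "(\<lambda>_. P) \<in> relaxed_controls M"
  unfolding relaxed_controls_def borel_of_def
  using assms by (intro measurable_const) (simp add: topspace_weak_convergence_topology space_measure_of_conv)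

text \<open>Weak* open sets are norm open. Measurability of the integrand can thus be checked for
  the norm topology, in which its series converges.\<close>

lemma borel_measurable_imp_weak_star_measurable:
  fixes g :: "'a \<Rightarrow> 'e::real_normed_vector \<Rightarrow>\<^sub>L real"
  assumes "g \<in> borel_measurable M"
  shows "g \<in> measurable M (borel_of weak_star_topology)"
  unfolding borel_of_def
proof (rule measurable_sigma_sets[OF sets_measure_of])
  fix U :: "('e \<Rightarrow>\<^sub>L real) set"
  assume "U \<in> {U. openin weak_star_topology U}"
  then have "open U"
    using openin_continuous_map_preimage[OF strong_operator_topology_weaker_than_euclidean, of U]
    by (simp add: weak_star_topology_def)
  then show "g -` U \<inter> space M \<in> sets M" using assms by (simp add: measurable_sets)
qed (auto simp: weak_star_topology_def strong_operator_topology_topspace)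

section \<open>An integrand that cannot be purified over a set with separable L1\<close>

theorem theorem3p4:
  fixes M :: "'t measure"
  assumes "complete_measure M" and "finite_measure M"
    and E_separable: "separable_space (euclidean :: 'e::banach topology)"
    and E_infinite_dim: "\<not> (\<exists>B :: 'e set. finite B \<and> span B = UNIV)"
    and X_compact: "compact (UNIV :: 'x::polish_space set)"
    and X_uncountable: "uncountable (UNIV :: 'x set)"
    and relaxation:
      "\<And>(\<Phi> :: 't \<times> 'x \<Rightarrow> 'e \<Rightarrow>\<^sub>L real) (\<kappa> :: 't \<Rightarrow> 'x measure).
         \<lbrakk> \<Phi> \<in> measurable (M \<Otimes>\<^sub>M borel) (borel_of weak_star_topology);
           integrably_bounded M \<Phi>;
           \<And>t. t \<in> space M \<Longrightarrow> continuous_map euclidean weak_star_topology (\<lambda>x. \<Phi> (t, x));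
           \<kappa> \<in> relaxed_controls M \<rbrakk>
         \<Longrightarrow> \<exists>f \<in> measurable M borel.
               gelfand_integral M (\<lambda>t. gelfand_integral (\<kappa> t) (\<lambda>x. \<Phi> (t, x)))
               = gelfand_integral M (\<lambda>t. \<Phi> (t, f t))"
  shows "saturated M"
proof (rule ccontr)
  interpret finite_measure M by fact
  assume "\<not> saturated M"
  then obtain S where S [measurable]: "S \<in> sets M" and S_pos: "emeasure M S > 0"
    and sep: "separable_space (L1_topology (restrict_space M S))"
    using \<open>finite_measure M\<close> by (auto simp: saturated_def)
  have S_int: "S \<inter> space M \<in> sets M" by simp
  have "finite_measure (restrict_space M S)"
    
    by (intro finite_measureI) (simp add: emeasure_restrict_space space_restrict_space)
  from separable_L1_determining_sequence[OF this sep]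
  obtain v :: "nat \<Rightarrow> 't \<Rightarrow> real" where
    v_meas: "\<And>n. v n \<in> borel_measurable (restrict_space M S)" and
    v_le: "\<And>n t. \<bar>v n t\<bar> \<le> 1" and
    v_det: "\<And>w. w \<in> borel_measurable (restrict_space M S) \<Longrightarrow> (\<And>t. \<bar>w t\<bar> \<le> 1) \<Longrightarrow>
      (\<And>n. (\<integral>t. v n t * w t \<partial>restrict_space M S) = 0) \<Longrightarrow>
      (\<integral>t. (w t)\<^sup>2 \<partial>restrict_space M S) = 0"
    by blast
  have [measurable]: "(\<lambda>t. indicator S t * v n t) \<in> borel_measurable M" for n
    using v_meas[of n] by (simp add: borel_measurable_restrict_space_iff)

  obtain p q :: 'x where pq: "p \<noteq> q"
    using X_uncountable by (metis UNIV_eq_I countable_empty countable_insert insertI1 singletonD)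
  \<comment> \<open>Dividing by \<open>dist q p\<close> gives \<open>h q = 1\<close>; the cap at 1
    keeps the range in [0, 1].\<close>
  define h where "h x = min 1 (dist x p / dist q p)" for x
  have h_cont: "continuous_on UNIV h"
    unfolding h_def using pq by (intro continuous_intros) auto
  have [measurable]: "h \<in> borel_measurable borel" using h_cont by (rule borel_measurable_continuous_onI)
  have h: "h p = 0" "h q = 1" "0 \<le> h x" "h x \<le> 1" for x using pq by (auto simp: h_def)

  obtain y :: "nat \<Rightarrow> 'e" and b0 :: "nat \<Rightarrow> 'e \<Rightarrow>\<^sub>L real"
    where biorth: "\<And>i j. blinfun_apply (b0 i) (y j) = (if i = j then 1 else 0)"
    using exists_biorthogonal_sequence[OF E_infinite_dim] by metis
  \<comment> \<open>The weights give \<open>norm (b n) \<le> (1/2) ^ n\<close> however fast the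
    norms of \<open>b0 n\<close> grow. Being nonzero, they preserve biorthogonality up to a factor
    on the diagonal.\<close>
  define b where "b n = ((1/2) ^ n / (1 + norm (b0 n))) *\<^sub>R b0 n" for n
  have pos: "1 + norm (b0 n) > 0" for n by (simp add: add_pos_nonneg)
  have b_summable: "summable (\<lambda>n. norm (b n))"
  proof (rule summable_comparison_test'[where N = 0])
    show "summable (\<lambda>n. (1/2 :: real) ^ n)" by (rule summable_geometric) simp
    show "norm (norm (b n)) \<le> (1/2) ^ n" for n
      using pos[of n] by (simp add: b_def divide_simps)
  qed
  have b_diag: "blinfun_apply (b m) (y m) \<noteq> 0" for m
    using pos[of m] by (simp add: b_def blinfun.scaleR_left biorth)
  have b_off: "blinfun_apply (b n) (y m) = 0" if "n \<noteq> m" for n m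
    using that by (simp add: b_def blinfun.scaleR_left biorth)

  \<comment> \<open>Index 0 holds the quadratic term, so \<open>v m\<close> sits at
    \<open>Suc m\<close>. At \<open>p\<close> every coefficient vanishes; at \<open>q\<close> only
    those with index \<open>Suc m\<close> can survive.\<close>
  define k where "k n = (\<lambda>(t, x). case n of 0 \<Rightarrow> indicator S t * ((h x)\<^sup>2 - h x)
      | Suc m \<Rightarrow> (indicator S t * v m t) * h x)" for n
  have [measurable]: "k n \<in> borel_measurable (M \<Otimes>\<^sub>M borel)" for n
    unfolding k_def by (cases n) (simp_all add: case_prod_beta)
  have k_le: "\<bar>k n z\<bar> \<le> 1" for n z
  proof -
    have "\<bar>(h x)\<^sup>2 - h x\<bar> \<le> 1" for x
      using h(3,4)[of x] mult_left_le_one_le[of "h x" "h x"] zero_le_square[of "h x"]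
      unfolding abs_le_iff power2_eq_square by linarith
    moreover have "\<bar>v m t * h x\<bar> \<le> 1" for m t x
      using v_le h(3,4)[of x] by (simp add: abs_mult mult_le_one)
    ultimately show ?thesis
      by (cases n) (auto simp: k_def case_prod_beta split: split_indicator)
  qed
  have k_clip: "max (- 1) (min 1 (k n z)) = k n z" for n z
    using k_le[of n z] by (auto simp: abs_le_iff)
  define \<Phi> where "\<Phi> z = (\<Sum>n. k n z *\<^sub>R b n)" for z
  define B where "B = (\<Sum>n. norm (b n))"
  \<comment> \<open>Clipping does not change the values of \<open>k\<close>, so
    \<open>\<Phi>\<close> is a continuous function of a measurable sequence.\<close>
  have \<Phi>_series: "\<Phi> = (\<lambda>c. \<Sum>n. max (- 1) (min 1 (c n)) *\<^sub>R b n) \<circ> (\<lambda>z n. k n z)"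
    by (auto simp: \<Phi>_def k_clip)
  have \<Phi>_meas [measurable]: "\<Phi> \<in> borel_measurable (M \<Otimes>\<^sub>M borel)"
    unfolding \<Phi>_series
    by (intro measurable_comp[OF measurable_coordinatewise_then_product]
        borel_measurable_continuous_onI[OF continuous_on_clipped_series[OF b_summable]]) measurable
  have \<Phi>_le: "norm (\<Phi> z) \<le> B" for z
    unfolding \<Phi>_def B_def by (intro summable_bounded_coefficients b_summable k_le)
  have \<Phi>_cont: "continuous_on UNIV (\<lambda>x. \<Phi> (t, x))" for t
  proof -
    have "continuous_on UNIV (\<lambda>x n. k n (t, x))"
    proof (rule continuous_on_coordinatewise_then_product)
      show "continuous_on UNIV (\<lambda>x. k n (t, x))" for n
        unfolding k_def by (cases n) (auto intro!: continuous_intros h_cont)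
    qed
    from continuous_on_compose2[OF continuous_on_clipped_series[OF b_summable] this]
    show ?thesis by (simp add: \<Phi>_def k_clip)
  qed
  \<comment> \<open>Biorthogonality makes \<open>y m\<close> pick out coefficient \<open>m\<close>,
    which turns equations in the dual into scalar ones.\<close>
  have \<Phi>_apply: "blinfun_apply (\<Phi> z) (y m) = k m z * blinfun_apply (b m) (y m)" for z m
  proof -
    have "blinfun_apply (\<Phi> z) (y m) = (\<Sum>n. blinfun_apply (k n z *\<^sub>R b n) (y m))"
      unfolding \<Phi>_def
      by (rule bounded_linear.suminf[OF blinfun.bounded_linear_left])
        (intro summable_bounded_coefficients b_summable k_le)
    also have "\<dots> = (\<Sum>n\<in>{m}. blinfun_apply (k n z *\<^sub>R b n) (y m))"
      by (rule suminf_finite) (auto simp: blinfun.scaleR_left b_off)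
    finally show ?thesis by (simp add: blinfun.scaleR_left)
  qed
  have \<Phi>_p: "\<Phi> (t, p) = 0" for t
  proof -
    have "k n (t, p) = 0" for n by (cases n) (simp_all add: k_def h)
    then show ?thesis by (simp add: \<Phi>_def)
  qed
  have apply_meas [measurable (raw)]: "(\<lambda>t. blinfun_apply (g t) z) \<in> borel_measurable N"
    if "g \<in> borel_measurable N" for g :: "'c \<Rightarrow> 'e \<Rightarrow>\<^sub>L real" and N z
    by (rule borel_measurable_continuous_on[OF _ that]) (intro continuous_intros)

  have "\<exists>f\<in>measurable M borel.
      gelfand_integral M (\<lambda>t. gelfand_integral (two_point_measure p q) (\<lambda>x. \<Phi> (t, x)))
      = gelfand_integral M (\<lambda>t. \<Phi> (t, f t))"
  proof (rule relaxation)
    show "\<Phi> \<in> measurable (M \<Otimes>\<^sub>M borel) (borel_of weak_star_topology)"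
      by (rule borel_measurable_imp_weak_star_measurable) measurable
    show "integrably_bounded M \<Phi>"
      unfolding integrably_bounded_def using \<Phi>_le by (intro exI[of _ "\<lambda>_. B"]) simp
    show "continuous_map euclidean weak_star_topology (\<lambda>x. \<Phi> (t, x))" for t
      unfolding weak_star_topology_def continuous_on_strong_operator_topo_iff_coordinatewise
      by (auto intro!: continuous_intros \<Phi>_cont)
  qed (intro const_in_relaxed_controls two_point_measure_in_borel_prob_measures)
  moreover have "gelfand_integral (two_point_measure p q) (\<lambda>x. \<Phi> (t, x)) = (1/2) *\<^sub>R \<Phi> (t, q)" for t
  proof -
    have "(\<lambda>x. blinfun_apply (\<Phi> (t, x)) z) \<in> borel_measurable borel" for z
      by (intro apply_meas borel_measurable_continuous_onI \<Phi>_cont)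
    from gelfand_integral_eq[OF has_gelfand_integral_two_point_measure[OF pq this]]
    show ?thesis by (simp add: \<Phi>_p)
  qed
  ultimately obtain f where f [measurable]: "f \<in> measurable M borel"
    and f_eq: "gelfand_integral M (\<lambda>t. (1/2) *\<^sub>R \<Phi> (t, q)) = gelfand_integral M (\<lambda>t. \<Phi> (t, f t))"
    by auto
  \<comment> \<open>\<open>gelfand_integral\<close> is a definite description, so the equation
    \<open>f_eq\<close> can be tested against vectors only once both integrals are known to exist;
    measurability and the bound \<open>B\<close> ensure this.\<close>
  have gelfand: "has_gelfand_integral M g (gelfand_integral M g)"
    if [measurable]: "g \<in> borel_measurable M" and le: "\<And>t. norm (g t) \<le> B"
    for g :: "'t \<Rightarrow> 'e \<Rightarrow>\<^sub>L real"
  proof (rule has_gelfand_integral_gelfand_integral)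
    show "integrable M (\<lambda>t. blinfun_apply (g t) z)" for z
    proof (rule integrable_const_bound[where B = "B * norm z"])
      show "AE t in M. norm (blinfun_apply (g t) z) \<le> B * norm z"
        using norm_blinfun mult_right_mono[OF le norm_ge_zero] by (intro AE_I2) (rule order_trans)
    qed measurable
    show "integrable M (\<lambda>_. B)" by simp
  qed (rule le)
  have k_eq: "(\<integral>t. (1/2) * k m (t, q) \<partial>M) = (\<integral>t. k m (t, f t) \<partial>M)" for m
  proof -
    have half: "norm ((1/2) *\<^sub>R \<Phi> (t, q)) \<le> B" for t
      by (rule order_trans[OF _ \<Phi>_le[of "(t, q)"]]) simp
    have half_meas: "(\<lambda>t. (1/2) *\<^sub>R \<Phi> (t, q)) \<in> borel_measurable M" by measurable
    have "(\<integral>t. blinfun_apply ((1/2) *\<^sub>R \<Phi> (t, q)) (y m) \<partial>M)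
        = (\<integral>t. blinfun_apply (\<Phi> (t, f t)) (y m) \<partial>M)"
      using gelfand[OF half_meas half] gelfand[of "\<lambda>t. \<Phi> (t, f t)", OF _ \<Phi>_le] f_eq
      unfolding has_gelfand_integral_def by simp
    then have "(\<integral>t. ((1/2) * k m (t, q)) * blinfun_apply (b m) (y m) \<partial>M)
        = (\<integral>t. k m (t, f t) * blinfun_apply (b m) (y m) \<partial>M)"
      by (simp only: blinfun.scaleR_left \<Phi>_apply real_scaleR_def mult.assoc)
    then show ?thesis unfolding integral_mult_left_zero using b_diag[of m] by simp
  qed

  \<comment> \<open>1/2 is the mean of \<open>h\<close> under the two-point measure, so
    \<open>w\<close> is the deviation of the pure control from the relaxed one.\<close>
  define w where "w t = h (f t) - 1/2" for t
  have w_meas [measurable]: "w \<in> borel_measurable M" unfolding w_def by measurable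
  have "(\<integral>t. (w t)\<^sup>2 \<partial>restrict_space M S) = 0"
  proof (rule v_det)
    show "w \<in> borel_measurable (restrict_space M S)" by (rule measurable_restrict_space1) measurable
    show "\<bar>w t\<bar> \<le> 1" for t using h(3,4)[of "f t"] by (simp add: w_def abs_le_iff)
    fix n
    have k_int: "integrable M (\<lambda>t. k (Suc n) (t, g t))" if [measurable]: "g \<in> measurable M borel" for g
      using k_le by (intro integrable_const_bound[where B = 1]) auto
    \<comment> \<open>Since \<open>h q = 1\<close>, the subtracted term is \<open>v n t / 2\<close>
      on \<open>S\<close>.\<close>
    have "(\<integral>t. v n t * w t \<partial>restrict_space M S)
        = (\<integral>t. k (Suc n) (t, f t) - (1/2) * k (Suc n) (t, q) \<partial>M)"
      unfolding integral_restrict_space[OF S_int]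
      by (intro Bochner_Integration.integral_cong) (auto simp: k_def h w_def algebra_simps)
    also have "\<dots> = (\<integral>t. k (Suc n) (t, f t) \<partial>M) - (\<integral>t. (1/2) * k (Suc n) (t, q) \<partial>M)"
      using k_int[of f] k_int[of "\<lambda>_. q"] by (intro Bochner_Integration.integral_diff) auto
    finally show "(\<integral>t. v n t * w t \<partial>restrict_space M S) = 0" using k_eq[of "Suc n"] by simp
  qed
  moreover have "(\<integral>t. (w t)\<^sup>2 \<partial>restrict_space M S) = measure M S / 4"
  proof -
    \<comment> \<open>Completing the square: on \<open>S\<close>, \<open>k 0 (t, f t)\<close> is the
      square of \<open>w t\<close> minus 1/4.\<close>
    have "(\<integral>t. (w t)\<^sup>2 \<partial>restrict_space M S) = (\<integral>t. k 0 (t, f t) + indicator S t / 4 \<partial>M)"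
      unfolding integral_restrict_space[OF S_int]
      by (intro Bochner_Integration.integral_cong)
        (auto simp: k_def w_def power2_eq_square field_simps split: split_indicator)
    also have "\<dots> = (\<integral>t. k 0 (t, f t) \<partial>M) + measure M S / 4"
      using k_le by (subst Bochner_Integration.integral_add)
        (auto intro!: integrable_const_bound[where B = 1] simp: less_top[symmetric])
    \<comment> \<open>\<open>k 0\<close> vanishes at \<open>q\<close>, where \<open>h\<close> is 1,
      so the relaxed side of \<open>k_eq\<close> is 0.\<close>
    also have "(\<integral>t. k 0 (t, f t) \<partial>M) = 0" using k_eq[of 0] by (simp add: k_def h)
    finally show ?thesis by simp
  qed
  ultimately show False using S_pos by (simp add: emeasure_eq_measure)
qed

end
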